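(* $ub(K_{2,m})=\frac m4+o(m)$ as $m\to\infty$.
   Context: $K_{2,m}$ is the complete bipartite graph with parts of sizes $2$ and $m$. A bar is a closed horizontal line segment of length $1$ in the plane. Two bars of an arrangement of pairwise disjoint bars see each other if there is an axis-parallel rectangle of positive width whose bottom side lies in one of them, whose top side lies in the other, and whose interior meets no bar of the arrangement. For a nonnegative integer $t$, a $t$-unit-bar visibility representation of a graph $G$ assigns to each vertex a set of at most $t$ bars, all bars pairwise disjoint, such that two distinct vertices are adjacent iff some bar of one sees some bar of the other; $ub(G)$ is the minimum such $t$. *)

theory Defs
  imports "Graph_Theory.Kuratowski" "HOL-Library.Landau_Symbols" Complex_Main
begin

definition unit_bar :: "(real \<times> real) set \<Rightarrow> bool" where
  "unit_bar B \<longleftrightarrow> (\<exists>x y. B = {x..x + 1} \<times> {y})"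

(* The rectangle is {a..b} \<times> {c..d} *)
definition spans_gap ::
  "(real \<times> real) set set \<Rightarrow> (real \<times> real) set \<Rightarrow> (real \<times> real) set \<Rightarrow> bool" where
  "spans_gap \<A> B C \<longleftrightarrow>
     (\<exists>a b c d. a < b \<and> c < d \<and> {a..b} \<times> {c} \<subseteq> B \<and> {a..b} \<times> {d} \<subseteq> C \<and>
        (\<forall>D\<in>\<A>. ({a<..<b} \<times> {c<..<d}) \<inter> D = {}))"

definition sees ::
  "(real \<times> real) set set \<Rightarrow> (real \<times> real) set \<Rightarrow> (real \<times> real) set \<Rightarrow> bool" where
  "sees \<A> B C \<longleftrightarrow> spans_gap \<A> B C \<or> spans_gap \<A> C B"

(* Undirected graphs are symmetric loop-free digraphs, an edge uv being the pair of
   arcs (u, v), (v, u). Bars are nonempty, so the second conjunct also forbids two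
   vertices from sharing a bar. *)
definition unit_bar_visibility_rep ::
  "nat \<Rightarrow> 'v pair_pre_digraph \<Rightarrow> ('v \<Rightarrow> (real \<times> real) set set) \<Rightarrow> bool" where
  "unit_bar_visibility_rep t G R \<longleftrightarrow>
     (\<forall>v\<in>pverts G. finite (R v) \<and> card (R v) \<le> t \<and> (\<forall>B\<in>R v. unit_bar B)) \<and>
     (\<forall>u\<in>pverts G. \<forall>v\<in>pverts G. \<forall>B\<in>R u. \<forall>C\<in>R v. (u, B) \<noteq> (v, C) \<longrightarrow> B \<inter> C = {}) \<and>
     (\<forall>u\<in>pverts G. \<forall>v\<in>pverts G. u \<noteq> v \<longrightarrow>
        ((u, v) \<in> parcs G \<longleftrightarrow> (\<exists>B\<in>R u. \<exists>C\<in>R v. sees (\<Union>w\<in>pverts G. R w) B C)))"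

(* Every finite graph has a representation for some t, e.g. one that uses a separate
   pair of bars for each edge. *)
definition ub :: "'v pair_pre_digraph \<Rightarrow> nat" where
  "ub G = (LEAST t. \<exists>R. unit_bar_visibility_rep t G R)"

definition complete_bipartite_graph :: "nat \<Rightarrow> nat \<Rightarrow> (nat + nat) pair_pre_digraph" where
  "complete_bipartite_graph a b =
     \<lparr>pverts = Inl ` {..<a} \<union> Inr ` {..<b},
      parcs = Inl ` {..<a} \<times> Inr ` {..<b} \<union> Inr ` {..<b} \<times> Inl ` {..<a}\<rparr>"

lemma complete_bipartite_digraph_complete_bipartite_graph:
  "complete_bipartite_digraph a b (with_proj (complete_bipartite_graph a b))"
proof -
  have "(Inl ` {..<a} :: (nat + nat) set) \<inter> Inr ` {..<b} = {}"
    by auto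
  moreover have "card (Inl ` {..<a} :: (nat + nat) set) = a"
    "card (Inr ` {..<b} :: (nat + nat) set) = b"
    by (simp_all add: card_image)
  ultimately show ?thesis
    unfolding complete_bipartite_digraph_pair_def complete_bipartite_graph_def
      pair_pre_digraph.simps
    by blast
qed

end

theory Submission
  imports Defs
begin

text \<open>
  Lower bound: let \<open>u\<close>, \<open>v\<close> be the two vertices of degree \<open>m\<close>; call their bars big. Every big bar
  has four corners (left or right end, upper or lower side), so there are at most \<open>8 t\<close> corners,
  while \<open>2 m\<close> pairs of a big vertex and a small vertex \<open>w\<close> have to be seen. Assume first that the
  pair is seen between a big bar \<open>B\<close> and a bar \<open>C\<close> lying further to the right. Slide the line of
  sight to the right, choosing the rightmost one. As all bars have length 1, \<open>C\<close> does not end before \<open>B\<close>.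
  So either the sight survives up to the right end of \<open>B\<close>, and the pair is charged to that corner, or
  it is blocked by bars that all begin at the same abscissa. One of these is big and has a left
  corner facing another big bar or a small bar that begins at the same abscissa; the pair is charged
  to this corner. Pairs seen between \<open>B\<close> and a bar \<open>C\<close> further to the left are treated
  symmetrically, and pairs seen only between bars that are exactly aligned get both charges. A corner
  charged in both ways belongs to such an aligned pair \<open>(x, w)\<close>, and then the pair \<open>(x', w)\<close>, with \<open>x'\<close>
  the other big vertex, is seen in the direction of the blocked charge. So an aligned pair that loses
  both of its charges yields a pair \<open>(x', w)\<close> that is seen in both directions and therefore has
  a charge to spare.

  Upper bound: put bars of \<open>u\<close> and \<open>v\<close> alternately on the unit intervals \<open>[k, k + 1]\<close>, consecutive ones
  at different heights so that the closed bars can abut without touching. Above and below this row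
  put one bar for each small vertex, on intervals \<open>[k + 1/2, k + 3/2]\<close>; each of them sees one \<open>u\<close> bar and
  one \<open>v\<close> bar, and the row separates the two sides.
\<close>

section \<open>Visibility among labelled bars\<close>

text \<open>
  The bars met by vertical lines just to the right (left) of the abscissa \<open>q\<close>. Between consecutive bar
  ends these sets are constant, so they describe all lines of sight.
\<close>

definition right_active :: "'b set \<Rightarrow> ('b \<Rightarrow> real) \<Rightarrow> real \<Rightarrow> 'b set" where
  "right_active A X q = {b \<in> A. X b \<le> q \<and> q < X b + 1}"

definition left_active :: "'b set \<Rightarrow> ('b \<Rightarrow> real) \<Rightarrow> real \<Rightarrow> 'b set" where
  "left_active A X q = {b \<in> A. X b < q \<and> q \<le> X b + 1}"

text \<open>Reflection in a vertical axis exchanges the two ends of a bar, hence the shift by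
  1.\<close>

definition mirror :: "('b \<Rightarrow> real) \<Rightarrow> 'b \<Rightarrow> real" where
  "mirror X = (\<lambda>b. - X b - 1)"

text \<open>The sign \<open>d\<close> is the direction of sight, \<open>1\<close> for upwards and \<open>-1\<close> for downwards.\<close>

definition next_bar :: "('b \<Rightarrow> real) \<Rightarrow> 'b set \<Rightarrow> real \<Rightarrow> 'b \<Rightarrow> 'b \<Rightarrow> bool" where
  "next_bar Y S d b c \<longleftrightarrow> d \<in> {1, -1} \<and> b \<in> S \<and> c \<in> S \<and> d * Y b < d * Y c \<and>
     (\<forall>e\<in>S. \<not> (d * Y b < d * Y e \<and> d * Y e < d * Y c))"

lemma mirror_mirror [simp]: "mirror (mirror X) = X"
  by (simp add: mirror_def)

lemma right_active_mirror [simp]: "right_active A (mirror X) q = left_active A X (- q)"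
  by (auto simp: right_active_def left_active_def mirror_def)

lemma left_active_mirror [simp]: "left_active A (mirror X) q = right_active A X (- q)"
  by (auto simp: right_active_def left_active_def mirror_def)

lemma next_bar_sym: "next_bar Y S d b c \<Longrightarrow> next_bar Y S (- d) c b"
  by (auto simp: next_bar_def)

text \<open>The value \<open>q'\<close> is the first bar end after \<open>q\<close>; it exists since
  an active bar still has to end. Nothing begins or ends strictly in between.\<close>

lemma right_active_eq_left_active:
  assumes "finite A" and "right_active A X q \<noteq> {}"
  obtains q' where "q < q'" and "q' \<in> X ` A \<union> (\<lambda>b. X b + 1) ` A"
    and "left_active A X q' = right_active A X q"
    and "\<And>e. e \<in> X ` A \<union> (\<lambda>b. X b + 1) ` A \<Longrightarrow> q < e \<Longrightarrow> q' \<le> e"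
proof -
  define E where "E = {e \<in> X ` A \<union> (\<lambda>b. X b + 1) ` A. q < e}"
  have fin: "finite E" using assms(1) by (simp add: E_def)
  have ne: "E \<noteq> {}" using assms(2) by (auto simp: E_def right_active_def)
  have mem: "Min E \<in> E" using fin ne by (rule Min_in)
  have le: "\<And>e. e \<in> E \<Longrightarrow> Min E \<le> e" using fin by simp
  have leX: "X b < Min E \<longleftrightarrow> X b \<le> q" if "b \<in> A" for b
    using le[of "X b"] mem that by (force simp: E_def)
  have leX1: "Min E \<le> X b + 1 \<longleftrightarrow> q < X b + 1" if "b \<in> A" for b
    using le[of "X b + 1"] mem that by (force simp: E_def)
  have "left_active A X (Min E) = right_active A X q"
    using leX leX1 by (auto simp: left_active_def right_active_def)
  moreover have "q < Min E" "Min E \<in> X ` A \<union> (\<lambda>b. X b + 1) ` A"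
    using mem by (simp_all add: E_def)
  ultimately show ?thesis using that[of "Min E"] le unfolding E_def by blast
qed

lemma left_active_eq_right_active:
  assumes "finite A" and "left_active A X q \<noteq> {}"
  obtains q' where "q' < q" and "right_active A X q' = left_active A X q"
proof -
  have "right_active A (mirror X) (- q) \<noteq> {}" using assms(2) by simp
  then obtain q' where "- q < q'" "left_active A (mirror X) q' = right_active A (mirror X) (- q)"
    using right_active_eq_left_active[OF assms(1)] by metis
  thus ?thesis using that[of "- q'"] by simp
qed

lemma next_bar_nonempty: "next_bar Y S d b c \<Longrightarrow> S \<noteq> {}"
  by (auto simp: next_bar_def)

text \<open>
  A bar of the big vertex \<open>x\<close> is labelled \<open>Inl x\<close>, one of the small vertex \<open>w\<close> is labelled \<open>Inr w\<close>.
\<close>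

definition rightward_pairs ::
  "'b set \<Rightarrow> ('b \<Rightarrow> real) \<Rightarrow> ('b \<Rightarrow> real) \<Rightarrow> ('b \<Rightarrow> nat + nat) \<Rightarrow> (nat \<times> nat) set" where
  "rightward_pairs A X Y lab =
     {(x, w). \<exists>q d B C. next_bar Y (left_active A X q) d B C \<and> lab B = Inl x \<and> lab C = Inr w \<and>
        X B < X C}"

text \<open>
  Charges of a pair \<open>P\<close> to the corner of a bar on its side \<open>d\<close>: at its right end if the sight of \<open>P\<close>
  survives up to there, at its left end if the bar begins between the bars \<open>B\<close> and \<open>C\<close> that
  see each other just before. In the second case the corner faces the bar \<open>N\<close>; its properties separate
  such corners from those charged through the mirror image, up to aligned pairs.
\<close>

definition end_charge ::
  "'b set \<Rightarrow> ('b \<Rightarrow> real) \<Rightarrow> ('b \<Rightarrow> real) \<Rightarrow> ('b \<Rightarrow> nat + nat) \<Rightarrow> nat \<times> nat \<Rightarrow> 'b \<Rightarrow> real \<Rightarrow> bool" where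
  "end_charge A X Y lab P B d \<longleftrightarrow> lab B = Inl (fst P) \<and>
     (\<exists>C. next_bar Y (left_active A X (X B + 1)) d B C \<and> lab C = Inr (snd P) \<and>
        (X B < X C \<or> X B = X C \<and> P \<notin> rightward_pairs A X Y lab))"

definition block_charge ::
  "'b set \<Rightarrow> ('b \<Rightarrow> real) \<Rightarrow> ('b \<Rightarrow> real) \<Rightarrow> ('b \<Rightarrow> nat + nat) \<Rightarrow> nat \<times> nat \<Rightarrow> 'b \<Rightarrow> real \<Rightarrow> bool" where
  "block_charge A X Y lab P D d \<longleftrightarrow> isl (lab D) \<and>
     (\<exists>B C. next_bar Y (left_active A X (X D)) (- d) B C \<and> lab B = Inl (fst P) \<and>
        lab C = Inr (snd P) \<and> - d * Y B < - d * Y D \<and> - d * Y D < - d * Y C) \<and>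
     (\<exists>N. next_bar Y (right_active A X (X D)) d D N \<and>
        (isl (lab N) \<or> X N = X D \<and>
          (\<exists>w. lab N = Inr w \<and> (fst P, w) \<in> rightward_pairs A X Y lab)))"

text \<open>The triple names a corner: bar, right or left end, side. In the mirrored arrangement the
  flag has the opposite geometric meaning.\<close>

definition charge ::
  "'b set \<Rightarrow> ('b \<Rightarrow> real) \<Rightarrow> ('b \<Rightarrow> real) \<Rightarrow> ('b \<Rightarrow> nat + nat) \<Rightarrow> nat \<times> nat \<Rightarrow> 'b \<times> bool \<times> real \<Rightarrow> bool" where
  "charge A X Y lab P \<sigma> \<longleftrightarrow> (case \<sigma> of (b, at_end, d) \<Rightarrow>
     if at_end then end_charge A X Y lab P b d else block_charge A X Y lab P b d)"

text \<open>This isolates what the charging argument needs from a representation. Equal labels are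
  allowed in \<open>bipartite\<close> because bars of one vertex may see each other.\<close>

locale labelled_bars =
  fixes A :: "'b set" and X Y :: "'b \<Rightarrow> real" and lab :: "'b \<Rightarrow> nat + nat" and m :: nat
  assumes finite_bars: "finite A"
    and disjoint_bars: "b \<in> A \<Longrightarrow> c \<in> A \<Longrightarrow> b \<noteq> c \<Longrightarrow> Y b = Y c \<Longrightarrow> 1 < \<bar>X b - X c\<bar>"
    and bipartite: "next_bar Y (right_active A X q) d b c \<Longrightarrow> lab b = lab c \<or> isl (lab b) \<noteq> isl (lab c)"
    and seen: "x < 2 \<Longrightarrow> w < m \<Longrightarrow>
      \<exists>q d B C. next_bar Y (right_active A X q) d B C \<and> lab B = Inl x \<and> lab C = Inr w"
begin

lemma bipartite_left:
  assumes "next_bar Y (left_active A X q) d b c"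
  shows "lab b = lab c \<or> isl (lab b) \<noteq> isl (lab c)"
  using left_active_eq_right_active[OF finite_bars next_bar_nonempty[OF assms]] bipartite assms
  by metis

text \<open>Transfers every result on rightward sights to leftward ones.\<close>

lemma mirrored: "labelled_bars A (mirror X) Y lab m"
proof
  fix x w :: nat assume "x < 2" "w < m"
  then obtain q d B C where *: "next_bar Y (right_active A X q) d B C"
    "lab B = Inl x" "lab C = Inr w" using seen by blast
  obtain q' where "left_active A X q' = right_active A X q"
    using right_active_eq_left_active[OF finite_bars next_bar_nonempty[OF *(1)]] by metis
  hence "next_bar Y (right_active A (mirror X) (- q')) d B C" using * by simp
  thus "\<exists>q d B C. next_bar Y (right_active A (mirror X) q) d B C \<and> lab B = Inl x \<and> lab C = Inr w"
    using * by blast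
next
  fix b c assume "b \<in> A" "c \<in> A" "b \<noteq> c" "Y b = Y c"
  hence "1 < \<bar>X b - X c\<bar>" by (rule disjoint_bars)
  thus "1 < \<bar>mirror X b - mirror X c\<bar>" by (simp add: mirror_def)
qed (use finite_bars bipartite_left in auto)

section \<open>Uniqueness and conflicts of charges\<close>

lemma height_inj:
  assumes "d \<in> {1, -1}" "d * Y b = d * Y c" and "b \<in> right_active A X q" "c \<in> right_active A X q"
  shows "b = c"
proof (rule ccontr)
  assume "b \<noteq> c"
  hence "1 < \<bar>X b - X c\<bar>" using assms disjoint_bars by (auto simp: right_active_def)
  thus False using assms by (auto simp: right_active_def)
qed

lemma height_inj_left:
  assumes "d \<in> {1, -1}" "d * Y b = d * Y c" and "b \<in> left_active A X q" "c \<in> left_active A X q"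
  shows "b = c"
  using labelled_bars.height_inj[OF mirrored assms(1,2), of "- q"] assms(3,4) by simp

lemma next_bar_unique:
  assumes "next_bar Y (left_active A X q) d b c" "next_bar Y (left_active A X q) d b c'"
  shows "c = c'"
proof -
  have "d * Y c = d * Y c'" using assms unfolding next_bar_def by (meson linorder_less_linear)
  thus ?thesis using assms height_inj_left[of d c c' q] by (auto simp: next_bar_def)
qed

lemma next_bar_around_unique:
  assumes "next_bar Y (left_active A X q) d b c" "d * Y b < h" "h < d * Y c"
    and "next_bar Y (left_active A X q) d b' c'" "d * Y b' < h" "h < d * Y c'"
  shows "b = b' \<and> c = c'"
proof -
  have "\<not> d * Y b < d * Y b'" "\<not> d * Y b' < d * Y b"
    using assms unfolding next_bar_def by (meson order.strict_trans)+
  hence "b = b'" using assms height_inj_left[of d b b' q] by (auto simp: next_bar_def)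
  thus ?thesis using assms next_bar_unique by blast
qed

text \<open>A right corner of \<open>b\<close> determines the bar it faces just before
  \<open>b\<close> ends; a left corner determines the two bars enclosing the height of
  \<open>b\<close> just before it begins. Their labels recover the pair.\<close>

lemma charge_inj:
  assumes "charge A X Y lab P \<sigma>" "charge A X Y lab P' \<sigma>"
  shows "P = P'"
proof (cases \<sigma>)
  case (fields b e d)
  show ?thesis
  proof (cases e)
    case True
    have "end_charge A X Y lab P b d" "end_charge A X Y lab P' b d"
      using assms fields True by (simp_all add: charge_def)
    thus ?thesis unfolding end_charge_def
      by (metis next_bar_unique prod_eqI sum.inject)
  next
    case False
    have "block_charge A X Y lab P b d" "block_charge A X Y lab P' b d"
      using assms fields False by (simp_all add: charge_def)
    then obtain B C B' C' where
      1: "next_bar Y (left_active A X (X b)) (- d) B C" "- d * Y B < - d * Y b" "- d * Y b < - d * Y C"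
        "next_bar Y (left_active A X (X b)) (- d) B' C'" "- d * Y B' < - d * Y b" "- d * Y b < - d * Y C'"
      and 2: "lab B = Inl (fst P)" "lab C = Inr (snd P)" "lab B' = Inl (fst P')" "lab C' = Inr (snd P')"
      unfolding block_charge_def by blast
    from next_bar_around_unique[OF 1] 2 show ?thesis by (simp add: prod_eqI)
  qed
qed

text \<open>Both charges concern the bar that \<open>b\<close> faces just left of its right end. The
  end charge makes this bar small, so the block charge makes it aligned with \<open>b\<close>, and
  only the aligned alternative of the end charge remains.\<close>

lemma charge_conflict:
  assumes "end_charge A X Y lab P b d" and "block_charge A (mirror X) Y lab P' b d"
  shows "P \<notin> rightward_pairs A X Y lab \<and> (fst P', snd P) \<in> rightward_pairs A (mirror X) Y lab"
proof -
  obtain C where C: "next_bar Y (left_active A X (X b + 1)) d b C" "lab C = Inr (snd P)"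
    "X b < X C \<or> X b = X C \<and> P \<notin> rightward_pairs A X Y lab"
    using assms(1) unfolding end_charge_def by blast
  obtain N where N: "next_bar Y (right_active A (mirror X) (mirror X b)) d b N"
    "isl (lab N) \<or> mirror X N = mirror X b \<and>
       (\<exists>w. lab N = Inr w \<and> (fst P', w) \<in> rightward_pairs A (mirror X) Y lab)"
    using assms(2) unfolding block_charge_def by blast
  have "next_bar Y (left_active A X (X b + 1)) d b N"
  proof -
    have "- mirror X b = X b + 1" by (simp add: mirror_def)
    thus ?thesis using N(1) by simp
  qed
  hence "N = C" using C next_bar_unique by blast
  thus ?thesis using N C by (auto simp: mirror_def)
qed

section \<open>Existence of charges\<close>

lemma finite_argmin:
  fixes f :: "'b \<Rightarrow> real"
  assumes "finite S" "S \<noteq> {}"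
  obtains a where "a \<in> S" "\<And>b. b \<in> S \<Longrightarrow> f a \<le> f b"
proof -
  have "Min (f ` S) \<in> f ` S" using assms by simp
  then obtain a where "a \<in> S" "f a = Min (f ` S)" by auto
  thus ?thesis using assms(1) by (intro that[of a]) auto
qed

lemma charge_exists:
  assumes sight: "next_bar Y (left_active A X q0) d0 B0 C0" "lab B0 = Inl x" "lab C0 = Inr w"
    and dir: "X B0 < X C0 \<or> X B0 = X C0 \<and> (x, w) \<notin> rightward_pairs A X Y lab"
  obtains b e d where "charge A X Y lab (x, w) (b, e, d)" "b \<in> A" "isl (lab b)" "d \<in> {1, -1}"
proof -
  let ?R = "rightward_pairs A X Y lab" and ?L = "left_active A X" and ?r = "right_active A X"
  define E where "E = X ` A \<union> (\<lambda>b. X b + 1) ` A"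
  define sees where "sees q d B C \<longleftrightarrow> next_bar Y (?L q) d B C \<and> lab B = Inl x \<and> lab C = Inr w \<and>
     (X B < X C \<or> X B = X C \<and> (x, w) \<notin> ?R)" for q d B C
  \<comment> \<open>Sights are recorded only just before bar ends, so there are finitely many
    candidates and a rightmost one exists.\<close>
  define Q where "Q = {q \<in> E. \<exists>d B C. sees q d B C}"
  have finQ: "finite Q" using finite_bars by (simp add: Q_def E_def)
  have step: "\<exists>q'>q. q' \<in> E \<and> ?L q' = ?r q" if "?r q \<noteq> {}" for q
    using right_active_eq_left_active[OF finite_bars that] unfolding E_def by metis
  obtain p where p: "?r p = ?L q0"
    using left_active_eq_right_active[OF finite_bars next_bar_nonempty[OF sight(1)]] by metis
  obtain q1 where "q1 \<in> E" "?L q1 = ?r p"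
    using step[of p] p next_bar_nonempty[OF sight(1)] by auto
  hence "q1 \<in> Q" using sight dir p unfolding Q_def sees_def by auto
  hence neQ: "Q \<noteq> {}" by auto
  define q where "q = Max Q"
  have "q \<in> Q" unfolding q_def using finQ neQ by (rule Max_in)
  then obtain d B C where s: "sees q d B C" unfolding Q_def by blast
  have qmax: "\<not> sees q' d' B' C'" if "q' \<in> E" "q < q'" for q' d' B' C'
    using Max_ge[OF finQ, of q'] that unfolding q_def Q_def by fastforce
  have nb: "next_bar Y (?L q) d B C" and lB: "lab B = Inl x" and lC: "lab C = Inr w"
    and BC: "X B < X C \<or> X B = X C \<and> (x, w) \<notin> ?R"
    using s by (auto simp: sees_def)
  have d: "d \<in> {1, -1}" "- d \<in> {1, -1}" using nb by (auto simp: next_bar_def)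
  have act: "B \<in> ?L q" "C \<in> ?L q" and dBC: "d * Y B < d * Y C" using nb by (auto simp: next_bar_def)
  show ?thesis
  proof (cases "q = X B + 1")
    case True
    hence "charge A X Y lab (x, w) (B, True, d)"
      using nb lB lC BC unfolding charge_def end_charge_def by auto
    thus ?thesis using that[of B True d] lB d act by (auto simp: left_active_def)
  next
    case False
    \<comment> \<open>As \<open>X B \<le> X C\<close>, the bar \<open>C\<close> does not end before
      \<open>B\<close>, so both continue beyond \<open>q\<close>. By maximality of \<open>q\<close>
      their sight does not, so some bar lies between them just right of \<open>q\<close>.\<close>
    hence act': "B \<in> ?r q" "C \<in> ?r q" using act BC by (auto simp: left_active_def right_active_def)
    obtain q2 where q2: "q < q2" "q2 \<in> E" "?L q2 = ?r q" using step[of q] act' by auto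
    have nn: "\<not> next_bar Y (?r q) d B C"
      using qmax[OF q2(2,1), of d B C] q2(3) lB lC BC by (simp add: sees_def)
    define K where "K = {e \<in> ?r q. d * Y B < d * Y e \<and> d * Y e < d * Y C}"
    \<comment> \<open>A blocker that began earlier would also block the sight just left of
      \<open>q\<close>.\<close>
    have start: "X e = q" if "e \<in> K" for e
    proof (rule ccontr)
      assume "X e \<noteq> q"
      hence "e \<in> ?L q" using that by (auto simp: K_def left_active_def right_active_def)
      thus False using nb that by (auto simp: next_bar_def K_def)
    qed
    have finr: "finite (?r q)" using finite_bars by (simp add: right_active_def)
    have "K \<noteq> {}" using nn d act' dBC by (auto simp: next_bar_def K_def)
    moreover have "finite K" using finr by (simp add: K_def)
    ultimately obtain D1 where D1: "D1 \<in> K" "\<And>e. e \<in> K \<Longrightarrow> d * Y D1 \<le> d * Y e"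
      using finite_argmin[of K "\<lambda>e. d * Y e"] by blast
    have nb1: "next_bar Y (?r q) d B D1"
      using D1 d act' unfolding next_bar_def K_def by fastforce
    have XD1: "X D1 = q" "D1 \<in> A" using start D1(1) by (auto simp: K_def right_active_def)
    have XB: "X B < q" using act by (simp add: left_active_def)
    show ?thesis
    proof (cases "lab D1")
      case (Inl x1)
      have "block_charge A X Y lab (x, w) D1 (- d)"
        unfolding block_charge_def using nb lB lC D1(1) XD1 next_bar_sym[OF nb1] Inl
        by (force simp: K_def)
      thus ?thesis using that[of D1 False "- d"] XD1 Inl d by (simp add: charge_def)
    next
      case (Inr w1)
      \<comment> \<open>The blocker begins at \<open>q\<close>, after \<open>B\<close>, so the sight
        from \<open>B\<close> to it is rightward. For \<open>w1 = w\<close> this sight would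
        contradict the maximality of \<open>q\<close>.\<close>
      have R1: "(x, w1) \<in> ?R"
      proof -
        have "next_bar Y (?L q2) d B D1" "X B < X D1" using nb1 q2(3) XB XD1 by simp_all
        thus ?thesis unfolding rightward_pairs_def using lB Inr by blast
      qed
      have "w1 \<noteq> w"
        using qmax[OF q2(2,1), of d B D1] q2(3) nb1 lB Inr XB XD1 by (auto simp: sees_def)
      \<comment> \<open>\<open>D\<close> is the first bar beyond \<open>B\<close> not labelled
        \<open>w1\<close>, and \<open>N\<close> is the last bar before it. As \<open>N\<close> is
        small and faces \<open>D\<close>, bipartiteness makes \<open>D\<close> big; so
        \<open>D\<close> is not \<open>C\<close> and is itself a blocker.\<close>
      define K' where "K' = {e \<in> ?r q. d * Y B < d * Y e \<and> lab e \<noteq> Inr w1}"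
      have CK: "C \<in> K'" using act' dBC lC \<open>w1 \<noteq> w\<close> by (auto simp: K'_def)
      have "finite K'" using finr by (simp add: K'_def)
      then obtain D where D: "D \<in> K'" "\<And>e. e \<in> K' \<Longrightarrow> d * Y D \<le> d * Y e"
        using finite_argmin[of K' "\<lambda>e. d * Y e"] CK by blast
      define M where "M = {e \<in> ?r q. d * Y B < d * Y e \<and> d * Y e < d * Y D}"
      have "D \<noteq> D1" using D(1) Inr by (auto simp: K'_def)
      hence "d * Y D \<noteq> d * Y D1"
        using height_inj[OF d(1), of D D1 q] D(1) D1(1) by (auto simp: K'_def K_def)
      hence "d * Y D1 < d * Y D" using nb1 D(1) unfolding next_bar_def K'_def by force
      hence "D1 \<in> M" using D1(1) by (auto simp: M_def K_def)
      moreover have "finite M" using finr by (simp add: M_def)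
      ultimately obtain N where N: "N \<in> M" "\<And>e. e \<in> M \<Longrightarrow> - (d * Y N) \<le> - (d * Y e)"
        using finite_argmin[of M "\<lambda>e. - (d * Y e)"] by blast
      have lN: "lab N = Inr w1" using N(1) D(2)[of N] unfolding M_def K'_def by force
      have nbN: "next_bar Y (?r q) d N D"
        using N D(1) d unfolding next_bar_def M_def K'_def by fastforce
      have "isl (lab D)" using bipartite[OF nbN] lN D(1) by (auto simp: K'_def)
      have "d * Y D \<le> d * Y C" using D(2) CK by blast
      moreover have "D \<noteq> C" using \<open>isl (lab D)\<close> lC by auto
      hence "d * Y D \<noteq> d * Y C" using height_inj[OF d(1), of D C q] D(1) act' by (auto simp: K'_def)
      ultimately have "d * Y D < d * Y C" by linarith
      hence DK: "D \<in> K" using D(1) by (simp add: K_def K'_def)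
      hence NK: "N \<in> K" using N(1) by (auto simp: K_def M_def)
      have "block_charge A X Y lab (x, w) D (- d)"
        unfolding block_charge_def using nb lB lC DK start[OF DK] start[OF NK] next_bar_sym[OF nbN] lN R1
          \<open>isl (lab D)\<close>
        by (force simp: K_def)
      thus ?thesis using that[of D False "- d"] DK d \<open>isl (lab D)\<close>
        by (simp add: charge_def K_def right_active_def)
    qed
  qed
qed

section \<open>Counting pairs by corners\<close>

lemma pair_seen:
  assumes "x < 2" "w < m"
  shows "(x, w) \<in> rightward_pairs A X Y lab \<or> (x, w) \<in> rightward_pairs A (mirror X) Y lab \<or>
    (\<exists>q d B C. next_bar Y (left_active A X q) d B C \<and> lab B = Inl x \<and> lab C = Inr w \<and> X B = X C)"
proof -
  obtain q d B C where *: "next_bar Y (right_active A X q) d B C" "lab B = Inl x" "lab C = Inr w"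
    using seen assms by blast
  obtain q' where q': "left_active A X q' = right_active A X q"
    using right_active_eq_left_active[OF finite_bars next_bar_nonempty[OF *(1)]] by metis
  have l: "next_bar Y (left_active A X q') d B C"
    and r: "next_bar Y (left_active A (mirror X) (- q)) d B C"
    using * q' by simp_all
  consider "X B < X C" | "mirror X B < mirror X C" | "X B = X C"
    unfolding mirror_def by linarith
  thus ?thesis
  proof cases
    case 1
    thus ?thesis unfolding rightward_pairs_def using l * by blast
  next
    case 2
    thus ?thesis unfolding rightward_pairs_def using r * by blast
  next
    case 3
    thus ?thesis using l * by blast
  qed
qed

text \<open>The third assumption admits pairs seen in neither strict direction. Such pairs have an
  aligned sight and get a second charge from the mirror image.\<close>

lemma pair_charged:
  assumes "x < 2" "w < m"
    and "(x, w) \<in> rightward_pairs A X Y lab \<or> (x, w) \<notin> rightward_pairs A (mirror X) Y lab"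
  shows "\<exists>b e d. charge A X Y lab (x, w) (b, e, d) \<and> b \<in> A \<and> isl (lab b) \<and> d \<in> {1, -1}"
proof -
  have "\<exists>q d B C. next_bar Y (left_active A X q) d B C \<and> lab B = Inl x \<and> lab C = Inr w \<and>
    (X B < X C \<or> X B = X C \<and> (x, w) \<notin> rightward_pairs A X Y lab)"
  proof (cases "(x, w) \<in> rightward_pairs A X Y lab")
    case True
    thus ?thesis unfolding rightward_pairs_def by blast
  next
    case False
    thus ?thesis using pair_seen[OF assms(1,2)] assms(3) by blast
  qed
  thus ?thesis using charge_exists by metis
qed

end

text \<open>Here \<open>R\<close>, \<open>L\<close>, \<open>N\<close> stand for the pairs seen
  rightward, leftward, and only in alignment; \<open>c\<close> exchanges the big vertices. A pair in
  \<open>N\<close> brings two charges; if both are lost in collisions, its partner lies in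
  \<open>R \<inter> L\<close> and has a charge to spare.\<close>

lemma card_le_two_charges:
  fixes r l :: "'p \<Rightarrow> 's" and c :: "'p \<Rightarrow> 'p"
  assumes fin: "finite S" "finite R" "finite L" "finite N"
    and disj: "N \<inter> (R \<union> L) = {}"
    and inj: "inj_on r (R \<union> N)" "inj_on l (L \<union> N)" "inj_on c N"
    and into: "r ` (R \<union> N) \<subseteq> S" "l ` (L \<union> N) \<subseteq> S"
    and conflict: "\<And>P Q. P \<in> R \<union> N \<Longrightarrow> Q \<in> L \<union> N \<Longrightarrow> r P = l Q \<Longrightarrow>
      P \<in> N \<and> c P \<in> L \<or> Q \<in> N \<and> c Q \<in> R"
  shows "card (R \<union> L \<union> N) \<le> card S"
proof -
  define N1 N2 where "N1 = {P \<in> N. c P \<in> L}" and "N2 = {P \<in> N. c P \<in> R}"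
  have finN: "finite N1" "finite N2" using fin by (simp_all add: N1_def N2_def)
  \<comment> \<open>Each slot used by both maps is attributed to a pair of \<open>N1\<close> through
    \<open>r\<close> or to a pair of \<open>N2\<close> through \<open>l\<close>.\<close>
  let ?I = "r ` (R \<union> N) \<inter> l ` (L \<union> N)"
  have "?I \<subseteq> r ` N1 \<union> l ` N2"
    using conflict unfolding N1_def N2_def by blast
  hence "card ?I \<le> card (r ` N1 \<union> l ` N2)" using finN by (intro card_mono) auto
  also have "\<dots> \<le> card N1 + card N2"
    using card_Un_le[of "r ` N1" "l ` N2"] card_image_le[OF finN(1), of r]
      card_image_le[OF finN(2), of l] by linarith
  also have "\<dots> = card (N1 \<union> N2) + card (N1 \<inter> N2)"
    using finN by (rule card_Un_Int)
  finally have I: "card ?I \<le> card (N1 \<union> N2) + card (N1 \<inter> N2)" .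
  have "card (N1 \<union> N2) \<le> card N"
    using fin by (intro card_mono) (auto simp: N1_def N2_def)
  moreover have "card (N1 \<inter> N2) \<le> card (R \<inter> L)"
    using fin inj(3) by (intro card_inj_on_le[of c]) (auto simp: N1_def N2_def inj_on_def)
  moreover have "card (r ` (R \<union> N)) = card R + card N" "card (l ` (L \<union> N)) = card L + card N"
    using fin disj card_image[OF inj(1)] card_image[OF inj(2)]
      card_Un_disjoint[of R N] card_Un_disjoint[of L N] by auto
  moreover have "card (r ` (R \<union> N)) + card (l ` (L \<union> N)) = card (r ` (R \<union> N) \<union> l ` (L \<union> N)) + card ?I"
    using fin by (intro card_Un_Int) auto
  moreover have "card (r ` (R \<union> N) \<union> l ` (L \<union> N)) \<le> card S"
    using fin into by (intro card_mono) auto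
  moreover have "card R + card L = card (R \<union> L) + card (R \<inter> L)"
    using fin by (intro card_Un_Int)
  moreover have "card (R \<union> L \<union> N) = card (R \<union> L) + card N"
    using fin disj by (intro card_Un_disjoint) auto
  ultimately show ?thesis using I by linarith
qed

lemma (in labelled_bars) card_pairs_le:
  "2 * m \<le> 4 * card {b \<in> A. isl (lab b)}"
proof -
  interpret M: labelled_bars A "mirror X" Y lab m by (rule mirrored)
  define pairs where "pairs = {..<2::nat} \<times> {..<m}"
  define S where "S = {b \<in> A. isl (lab b)} \<times> (UNIV :: bool set) \<times> {1, -1 :: real}"
  define Rt Lt where "Rt = pairs \<inter> rightward_pairs A X Y lab"
    and "Lt = pairs \<inter> rightward_pairs A (mirror X) Y lab"
  define N where "N = pairs - (Rt \<union> Lt)"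
  \<comment> \<open>The right end in the mirror image is the left end of the actual bar. After
    \<open>flip\<close>, both kinds of charges refer to the same set of corners.\<close>
  define flip :: "'b \<times> bool \<times> real \<Rightarrow> 'b \<times> bool \<times> real" where "flip = (\<lambda>(b, e, d). (b, \<not> e, d))"
  define c :: "nat \<times> nat \<Rightarrow> nat \<times> nat" where "c = (\<lambda>(x, w). (1 - x, w))"
  have finP: "finite pairs" by (simp add: pairs_def)
  have finS: "finite S" using finite_bars by (simp add: S_def)
  have "\<forall>P\<in>Rt \<union> N. \<exists>\<sigma>\<in>S. charge A X Y lab P \<sigma>"
  proof
    fix P assume P: "P \<in> Rt \<union> N"
    obtain x w where "P = (x, w)" by fastforce
    thus "\<exists>\<sigma>\<in>S. charge A X Y lab P \<sigma>"
      using P pair_charged[of x w] by (fastforce simp: S_def N_def Rt_def Lt_def pairs_def)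
  qed
  then obtain r where r: "\<And>P. P \<in> Rt \<union> N \<Longrightarrow> r P \<in> S \<and> charge A X Y lab P (r P)"
    by metis
  have "\<forall>P\<in>Lt \<union> N. \<exists>\<sigma>\<in>S. charge A (mirror X) Y lab P (flip \<sigma>)"
  proof
    fix P assume P: "P \<in> Lt \<union> N"
    obtain x w where xw: "P = (x, w)" by fastforce
    obtain b e d where "charge A (mirror X) Y lab P (b, e, d)" "b \<in> A" "isl (lab b)" "d \<in> {1, -1}"
      using P xw M.pair_charged[of x w] by (fastforce simp: N_def Rt_def Lt_def pairs_def)
    hence "(b, \<not> e, d) \<in> S \<and> charge A (mirror X) Y lab P (flip (b, \<not> e, d))"
      by (simp add: S_def flip_def)
    thus "\<exists>\<sigma>\<in>S. charge A (mirror X) Y lab P (flip \<sigma>)" by blast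
  qed
  then obtain l where l: "\<And>P. P \<in> Lt \<union> N \<Longrightarrow> l P \<in> S \<and> charge A (mirror X) Y lab P (flip (l P))"
    by metis
  have "card (Rt \<union> Lt \<union> N) \<le> card S"
  proof (rule card_le_two_charges[where r = r and l = l and c = c])
    show "inj_on r (Rt \<union> N)" using r charge_inj by (metis inj_onI)
    show "inj_on l (Lt \<union> N)" using l M.charge_inj by (metis inj_onI)
    show "inj_on c N" by (auto simp: inj_on_def c_def N_def pairs_def)
    show "r ` (Rt \<union> N) \<subseteq> S" using r by blast
    show "l ` (Lt \<union> N) \<subseteq> S" using l by blast
    fix P Q assume P: "P \<in> Rt \<union> N" and Q: "Q \<in> Lt \<union> N" and eq: "r P = l Q"
    have PQ: "P \<in> pairs" "Q \<in> pairs" using P Q by (auto simp: Rt_def Lt_def N_def)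
    have other: "(fst Q', snd P') = c P' \<and> c P' \<in> pairs"
      if "P' \<in> pairs" "Q' \<in> pairs" "fst Q' \<noteq> fst P'" for P' Q'
      using that by (auto simp: pairs_def c_def)
    obtain b e d where s: "r P = (b, e, d)" by (metis prod_cases3)
    have cP: "charge A X Y lab P (b, e, d)" and cQ: "charge A (mirror X) Y lab Q (b, \<not> e, d)"
    proof -
      have "l Q = (b, e, d)" using eq s by simp
      thus "charge A X Y lab P (b, e, d)" "charge A (mirror X) Y lab Q (b, \<not> e, d)"
        using r[OF P] l[OF Q] s by (simp_all add: flip_def)
    qed
    show "P \<in> N \<and> c P \<in> Lt \<or> Q \<in> N \<and> c Q \<in> Rt"
    proof (cases e)
      case True
      have "P \<notin> rightward_pairs A X Y lab \<and> (fst Q, snd P) \<in> rightward_pairs A (mirror X) Y lab"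
        using charge_conflict[of P b d Q] cP cQ True by (simp add: charge_def)
      moreover from this have "P \<in> N" using P by (auto simp: Rt_def)
      \<comment> \<open>Since \<open>P\<close> is not seen leftward, \<open>fst Q\<close> differs
        from \<open>fst P\<close>, so \<open>(fst Q, snd P)\<close> is \<open>c P\<close>.\<close>
      ultimately have "P \<in> N \<and> c P \<in> Lt"
        using other[OF PQ] PQ unfolding Lt_def N_def by (metis DiffE IntI UnCI prod.collapse)
      thus ?thesis ..
    next
      case False
      have "Q \<notin> rightward_pairs A (mirror X) Y lab \<and> (fst P, snd Q) \<in> rightward_pairs A X Y lab"
        using M.charge_conflict[of Q b d P] cP cQ False by (simp add: charge_def)
      moreover from this have "Q \<in> N" using Q by (auto simp: Lt_def)
      ultimately have "Q \<in> N \<and> c Q \<in> Rt"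
        using other[OF PQ(2,1)] PQ unfolding Rt_def N_def by (metis DiffE IntI UnCI prod.collapse)
      thus ?thesis ..
    qed
  qed (use finS finP in \<open>auto simp: Rt_def Lt_def N_def\<close>)
  also have "Rt \<union> Lt \<union> N = pairs" by (auto simp: Rt_def Lt_def N_def)
  also have "card pairs = 2 * m" by (simp add: pairs_def)
  also have "card S = 4 * card {b \<in> A. isl (lab b)}"
    by (simp add: S_def card_cartesian_product)
  finally show ?thesis .
qed

section \<open>Bounds on the number of bars\<close>

lemma spans_gap_imp_next_bar:
  assumes BC: "B \<in> \<A>" "C \<in> \<A>" and bars: "\<And>D. D \<in> \<A> \<Longrightarrow> D = {X D..X D + 1} \<times> {Y D}"
    and gap: "spans_gap \<A> B C"
  shows "\<exists>q. next_bar Y (right_active \<A> X q) 1 B C"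
proof -
  obtain a b c d where abcd: "a < b" "c < d" "{a..b} \<times> {c} \<subseteq> B" "{a..b} \<times> {d} \<subseteq> C"
    and empty: "\<forall>D\<in>\<A>. ({a<..<b} \<times> {c<..<d}) \<inter> D = {}"
    using gap unfolding spans_gap_def by (elim exE conjE)
  have "(a, c) \<in> B" "(b, c) \<in> B" "(a, d) \<in> C" "(b, d) \<in> C"
    using abcd(1) by (auto intro!: subsetD[OF abcd(3)] subsetD[OF abcd(4)])
  hence "(a, c) \<in> {X B..X B + 1} \<times> {Y B}" "(b, c) \<in> {X B..X B + 1} \<times> {Y B}"
    "(a, d) \<in> {X C..X C + 1} \<times> {Y C}" "(b, d) \<in> {X C..X C + 1} \<times> {Y C}"
    by (fold bars[OF BC(1)] bars[OF BC(2)])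
  hence B: "X B \<le> a" "b \<le> X B + 1" "Y B = c" and C: "X C \<le> a" "b \<le> X C + 1" "Y C = d" by auto
  have False if e: "e \<in> right_active \<A> X a" "c < Y e" "Y e < d" for e
  proof -
    \<comment> \<open>An abscissa at which \<open>e\<close> would cross the interior of the
      rectangle.\<close>
    define s where "s = (a + min b (X e + 1)) / 2"
    have eA: "e \<in> \<A>" "X e \<le> a" "a < X e + 1" using e by (auto simp: right_active_def)
    hence s: "a < s" "s < b" "X e \<le> s" "s \<le> X e + 1" using abcd(1) by (auto simp: s_def min_def)
    hence "(s, Y e) \<in> {X e..X e + 1} \<times> {Y e}" by simp
    hence "(s, Y e) \<in> e" using bars[OF eA(1)] by simp
    moreover have "(s, Y e) \<in> {a<..<b} \<times> {c<..<d}" using s e by simp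
    ultimately show False using empty eA(1) by blast
  qed
  moreover have "B \<in> right_active \<A> X a" "C \<in> right_active \<A> X a"
    using B C BC abcd(1) by (auto simp: right_active_def)
  ultimately have "next_bar Y (right_active \<A> X a) 1 B C"
    using B C abcd(2) by (auto simp: next_bar_def)
  thus ?thesis ..
qed

lemma next_bar_imp_spans_gap:
  assumes fin: "finite \<A>" and bars: "\<And>D. D \<in> \<A> \<Longrightarrow> D = {X D..X D + 1} \<times> {Y D}"
    and nb: "next_bar Y (right_active \<A> X q) 1 B C"
  shows "spans_gap \<A> B C"
proof -
  \<comment> \<open>The rectangle reaches from \<open>q\<close> to the next bar end; a bar meeting
    its interior is then already active just right of \<open>q\<close>.\<close>
  obtain q' where q': "q < q'" "left_active \<A> X q' = right_active \<A> X q"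
    "\<And>e. e \<in> X ` \<A> \<union> (\<lambda>b. X b + 1) ` \<A> \<Longrightarrow> q < e \<Longrightarrow> q' \<le> e"
    using right_active_eq_left_active[OF fin next_bar_nonempty[OF nb]] by metis
  have r: "B \<in> right_active \<A> X q" "C \<in> right_active \<A> X q" and Y: "Y B < Y C"
    using nb by (auto simp: next_bar_def)
  hence "B \<in> left_active \<A> X q'" "C \<in> left_active \<A> X q'" using q' by auto
  with r have B: "B \<in> \<A>" "X B \<le> q" "q' \<le> X B + 1" and C: "C \<in> \<A>" "X C \<le> q" "q' \<le> X C + 1"
    by (auto simp: left_active_def right_active_def)
  have "{q..q'} \<times> {Y B} \<subseteq> {X B..X B + 1} \<times> {Y B}" "{q..q'} \<times> {Y C} \<subseteq> {X C..X C + 1} \<times> {Y C}"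
    using B C by auto
  hence "{q..q'} \<times> {Y B} \<subseteq> B" "{q..q'} \<times> {Y C} \<subseteq> C" using bars B(1) C(1) by metis+
  moreover have "({q<..<q'} \<times> {Y B<..<Y C}) \<inter> D = {}" if D: "D \<in> \<A>" for D
  proof (rule ccontr)
    assume "({q<..<q'} \<times> {Y B<..<Y C}) \<inter> D \<noteq> {}"
    then obtain s h where p: "q < s" "s < q'" "Y B < h" "h < Y C" "(s, h) \<in> D" by auto
    have "(s, h) \<in> {X D..X D + 1} \<times> {Y D}" using p(5) bars[OF D] by simp
    hence sh: "X D \<le> s" "s \<le> X D + 1" "h = Y D" by auto
    have "X D \<le> q" using q'(3)[of "X D"] D p sh by force
    hence "D \<in> right_active \<A> X q" using D p sh by (simp add: right_active_def)
    thus False using nb p sh by (auto simp: next_bar_def)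
  qed
  ultimately show ?thesis using q'(1) Y unfolding spans_gap_def by blast
qed

lemma unit_bar_visibility_rep_lower_bound:
  assumes rep: "unit_bar_visibility_rep t (complete_bipartite_graph 2 m) R"
  shows "m \<le> 4 * t"
proof -
  define V :: "(nat + nat) set" where "V = Inl ` {..<2} \<union> Inr ` {..<m}"
  define \<A> where "\<A> = (\<Union>v\<in>V. R v)"
  have V: "pverts (complete_bipartite_graph 2 m) = V"
    by (simp add: V_def complete_bipartite_graph_def)
  have arcs: "(u, v) \<in> parcs (complete_bipartite_graph 2 m) \<longleftrightarrow> isl u \<noteq> isl v" if "u \<in> V" "v \<in> V" for u v
    using that by (auto simp: V_def complete_bipartite_graph_def)
  have finR: "\<And>v. v \<in> V \<Longrightarrow> finite (R v) \<and> card (R v) \<le> t \<and> (\<forall>B\<in>R v. unit_bar B)"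
    and disj: "\<And>u v B C. u \<in> V \<Longrightarrow> v \<in> V \<Longrightarrow> B \<in> R u \<Longrightarrow> C \<in> R v \<Longrightarrow> (u, B) \<noteq> (v, C) \<Longrightarrow> B \<inter> C = {}"
    and vis: "\<And>u v. u \<in> V \<Longrightarrow> v \<in> V \<Longrightarrow> u \<noteq> v \<Longrightarrow>
      (u, v) \<in> parcs (complete_bipartite_graph 2 m) \<longleftrightarrow> (\<exists>B\<in>R u. \<exists>C\<in>R v. sees \<A> B C)"
    using rep unfolding unit_bar_visibility_rep_def V \<A>_def by simp_all
  have fin: "finite \<A>" using finR by (simp add: \<A>_def V_def)
  have "\<forall>B\<in>\<A>. \<exists>x y. B = {x..x + 1} \<times> {y}" using finR unfolding \<A>_def unit_bar_def by blast
  then obtain X Y where bars: "\<And>B. B \<in> \<A> \<Longrightarrow> B = {X B..X B + 1} \<times> {Y B}" by metis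
  have "\<forall>B\<in>\<A>. \<exists>v\<in>V. B \<in> R v" by (auto simp: \<A>_def)
  then obtain lab where lab: "\<And>B. B \<in> \<A> \<Longrightarrow> lab B \<in> V \<and> B \<in> R (lab B)" by metis
  have nonempty: "B \<noteq> {}" if "B \<in> \<A>" for B by (subst bars[OF that]) simp
  \<comment> \<open>A bar owned by two vertices would be disjoint from itself.\<close>
  have lab_eq: "lab B = v" if "v \<in> V" "B \<in> R v" for B v
    using disj[of "lab B" v B B] lab[of B] nonempty[of B] that by (auto simp: \<A>_def)
  interpret labelled_bars \<A> X Y lab m
  proof
    show "finite \<A>" by (rule fin)
  next
    fix b c assume bc: "b \<in> \<A>" "c \<in> \<A>" "b \<noteq> c" "Y b = Y c"
    have "b \<inter> c = {}" using disj[of "lab b" "lab c" b c] lab bc by blast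
    hence "({X b..X b + 1} \<times> {Y b}) \<inter> ({X c..X c + 1} \<times> {Y c}) = {}"
      by (fold bars[OF bc(1)] bars[OF bc(2)])
    \<comment> \<open>If the left ends differed by at most 1, the greater one would be the abscissa
      of a common point.\<close>
    hence "(max (X b) (X c), Y b) \<notin> ({X b..X b + 1} \<times> {Y b}) \<inter> ({X c..X c + 1} \<times> {Y c})"
      by simp
    thus "1 < \<bar>X b - X c\<bar>" using bc(4) by (auto simp: max_def split: if_splits)
  next
    fix q d b c assume nb: "next_bar Y (right_active \<A> X q) d b c"
    have bc: "b \<in> \<A>" "c \<in> \<A>" "d = 1 \<or> d = -1" using nb by (auto simp: next_bar_def right_active_def)
    have "sees \<A> b c"
    proof (cases "d = 1")
      case True
      thus ?thesis using next_bar_imp_spans_gap[OF fin bars] nb by (simp add: sees_def)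
    next
      case False
      thus ?thesis using next_bar_imp_spans_gap[OF fin bars] next_bar_sym[OF nb] bc by (simp add: sees_def)
    qed
    thus "lab b = lab c \<or> isl (lab b) \<noteq> isl (lab c)"
      using vis[of "lab b" "lab c"] arcs[of "lab b" "lab c"] lab bc by blast
  next
    fix x w assume "x < (2::nat)" "w < m"
    hence V': "Inl x \<in> V" "Inr w \<in> V" by (auto simp: V_def)
    then obtain B C where BC: "B \<in> R (Inl x)" "C \<in> R (Inr w)" "sees \<A> B C"
      using vis[of "Inl x" "Inr w"] arcs[of "Inl x" "Inr w"] by auto
    hence A: "B \<in> \<A>" "C \<in> \<A>" using V' by (auto simp: \<A>_def)
    have "\<exists>q d. next_bar Y (right_active \<A> X q) d B C"
      using BC(3) spans_gap_imp_next_bar[OF A bars] spans_gap_imp_next_bar[OF A(2,1) bars]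
        next_bar_sym unfolding sees_def by metis
    thus "\<exists>q d B C. next_bar Y (right_active \<A> X q) d B C \<and> lab B = Inl x \<and> lab C = Inr w"
      using lab_eq[OF V'(1) BC(1)] lab_eq[OF V'(2) BC(2)] by blast
  qed
  have V01: "Inl 0 \<in> V" "Inl 1 \<in> V" by (auto simp: V_def)
  have "{b \<in> \<A>. isl (lab b)} \<subseteq> R (Inl 0) \<union> R (Inl 1)"
  proof
    fix b assume "b \<in> {b \<in> \<A>. isl (lab b)}"
    hence "b \<in> R (lab b)" "lab b = Inl 0 \<or> lab b = Inl 1" using lab[of b] by (auto simp: V_def less_2_cases_iff)
    thus "b \<in> R (Inl 0) \<union> R (Inl 1)" by auto
  qed
  hence "card {b \<in> \<A>. isl (lab b)} \<le> card (R (Inl 0) \<union> R (Inl 1))"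
    using finR V01 by (intro card_mono) auto
  also have "\<dots> \<le> card (R (Inl 0)) + card (R (Inl 1))" by (rule card_Un_le)
  also have "\<dots> \<le> 2 * t" using finR V01 by (simp add: add_mono mult_2)
  finally show ?thesis using card_pairs_le by linarith
qed

section \<open>The construction with an alternating row\<close>

definition bar_at :: "real \<Rightarrow> real \<Rightarrow> (real \<times> real) set" where
  "bar_at x y = {x..x + 1} \<times> {y}"

definition row_bar :: "nat \<Rightarrow> (real \<times> real) set" where
  "row_bar k = bar_at (real k) (real (k mod 2))"

text \<open>Bars on one side abut as well, so two heights alternate there; all avoid the row heights
  0 and 1.\<close>

definition side_height :: "nat \<Rightarrow> real" where
  "side_height j = (if even j then 2 else -2) + real (j div 2 mod 2)"

text \<open>Parity of \<open>j\<close> picks the side. The shift by 1/2 gives an overlap of length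
  1/2 with the row bars \<open>j div 2\<close> and \<open>j div 2 + 1\<close>, which belong to
  different big vertices.\<close>

definition side_bar :: "nat \<Rightarrow> (real \<times> real) set" where
  "side_bar j = bar_at (real (j div 2) + 1 / 2) (side_height j)"

lemma unit_bar_bar_at: "unit_bar (bar_at x y)"
  by (auto simp: unit_bar_def bar_at_def)

lemma spans_gap_bar_at:
  "spans_gap \<A> (bar_at x y) (bar_at x' y') \<longleftrightarrow> y < y' \<and>
     (\<exists>a b. a < b \<and> x \<le> a \<and> b \<le> x + 1 \<and> x' \<le> a \<and> b \<le> x' + 1 \<and>
        (\<forall>D\<in>\<A>. ({a<..<b} \<times> {y<..<y'}) \<inter> D = {}))"
proof -
  have *: "{a..b} \<times> {c} \<subseteq> bar_at x y \<longleftrightarrow> c = y \<and> x \<le> a \<and> b \<le> x + 1" if "a < b" for a b c x y :: real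
    using that by (auto simp: bar_at_def subset_iff)
  show ?thesis unfolding spans_gap_def using * by (metis (no_types, lifting))
qed

lemma bar_at_disjoint: "y \<noteq> y' \<or> 1 < \<bar>x - x'\<bar> \<Longrightarrow> bar_at x y \<inter> bar_at x' y' = {}"
  by (auto simp: bar_at_def)

lemma mod_2_eq_gap: "k \<noteq> k' \<Longrightarrow> k mod 2 = k' mod 2 \<Longrightarrow> k + 2 \<le> k' \<or> k' + 2 \<le> k" for k k' :: nat
  by presburger

lemma div_2_eq_parity: "j \<noteq> j' \<Longrightarrow> j div 2 = j' div 2 \<Longrightarrow> even j \<noteq> even j'" for j j' :: nat
  by (metis even_two_times_div_two odd_two_times_div_two_succ)

lemma row_bar_disjoint:
  assumes "k \<noteq> k'" shows "row_bar k \<inter> row_bar k' = {}"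
  unfolding row_bar_def
proof (rule bar_at_disjoint)
  have "k mod 2 = k' mod 2 \<Longrightarrow> k + 2 \<le> k' \<or> k' + 2 \<le> k" using assms by (rule mod_2_eq_gap)
  thus "real (k mod 2) \<noteq> real (k' mod 2) \<or> 1 < \<bar>real k - real k'\<bar>" by force
qed

lemma side_height_cases:
  "even j \<Longrightarrow> 2 \<le> side_height j" "odd j \<Longrightarrow> side_height j \<le> -1"
proof -
  have "real (j div 2 mod 2) \<le> 1" by (simp add: of_nat_le_1_iff)
  thus "even j \<Longrightarrow> 2 \<le> side_height j" "odd j \<Longrightarrow> side_height j \<le> -1"
    by (auto simp: side_height_def)
qed

lemma row_height_le: "real (k mod 2) \<le> 1"
  by simp

lemma side_bar_disjoint:
  assumes "j \<noteq> j'" shows "side_bar j \<inter> side_bar j' = {}"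
  unfolding side_bar_def
proof (rule bar_at_disjoint)
  have "even j = even j' \<Longrightarrow> j div 2 mod 2 = j' div 2 mod 2 \<Longrightarrow>
      j div 2 + 2 \<le> j' div 2 \<or> j' div 2 + 2 \<le> j div 2"
  proof -
    assume "even j = even j'" and eq: "j div 2 mod 2 = j' div 2 mod 2"
    hence "j div 2 \<noteq> j' div 2" using assms div_2_eq_parity by blast
    thus "j div 2 + 2 \<le> j' div 2 \<or> j' div 2 + 2 \<le> j div 2" using eq by (rule mod_2_eq_gap)
  qed
  moreover have "even j = even j' \<and> j div 2 mod 2 = j' div 2 mod 2" if "side_height j = side_height j'"
  proof
    show e: "even j = even j'" using that side_height_cases[of j] side_height_cases[of j'] by fastforce
    show "j div 2 mod 2 = j' div 2 mod 2" using that e by (simp add: side_height_def split: if_splits)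
  qed
  ultimately show "side_height j \<noteq> side_height j' \<or>
      1 < \<bar>real (j div 2) + 1 / 2 - (real (j' div 2) + 1 / 2)\<bar>"
    by force
qed

lemma row_side_disjoint: "row_bar k \<inter> side_bar j = {}"
  unfolding row_bar_def side_bar_def
  using side_height_cases[of j] row_height_le[of k] by (intro bar_at_disjoint) (cases "even j"; force)

lemma unit_bar_visibility_rep_upper_bound:
  "\<exists>R. unit_bar_visibility_rep (m div 4 + 2) (complete_bipartite_graph 2 m) R"
proof -
  \<comment> \<open>The \<open>2 * t\<close> row bars must include the index
    \<open>j div 2 + 1\<close> for every \<open>j < m\<close>.\<close>
  define t where "t = m div 4 + 2"
  define R :: "nat + nat \<Rightarrow> (real \<times> real) set set" where
    "R = case_sum (\<lambda>x. (\<lambda>i. row_bar (2 * i + x)) ` {..<t}) (\<lambda>j. {side_bar j})"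
  define V :: "(nat + nat) set" where "V = Inl ` {..<2} \<union> Inr ` {..<m}"
  define \<A> where "\<A> = (\<Union>v\<in>V. R v)"
  have V: "pverts (complete_bipartite_graph 2 m) = V"
    by (simp add: V_def complete_bipartite_graph_def)
  have arcs: "(u, v) \<in> parcs (complete_bipartite_graph 2 m) \<longleftrightarrow> isl u \<noteq> isl v" if "u \<in> V" "v \<in> V" for u v
    using that by (auto simp: V_def complete_bipartite_graph_def)
  have R_row: "row_bar k \<in> R (Inl (k mod 2))" if "k < 2 * t" for k
  proof -
    have "row_bar k = row_bar (2 * (k div 2) + k mod 2)" by simp
    moreover have "k div 2 < t" using that by simp
    ultimately show ?thesis unfolding R_def by (simp only: sum.case) blast
  qed
  have row_in: "row_bar k \<in> \<A>" if "k < 2 * t" for k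
    using R_row[OF that] by (auto simp: \<A>_def V_def)
  have row_of: "\<exists>k. B = row_bar k \<and> k mod 2 = x" if "B \<in> R (Inl x)" "x < 2" for B x
    using that by (force simp: R_def)
  have side_of: "B = side_bar j" if "B \<in> R (Inr j)" for B j using that by (simp add: R_def)
  have A_cases: "(\<exists>k. D = row_bar k) \<or> (\<exists>j. D = side_bar j)" if "D \<in> \<A>" for D
    using that row_of side_of by (fastforce simp: \<A>_def V_def)
  have size: "finite (R v) \<and> card (R v) \<le> t \<and> (\<forall>B\<in>R v. unit_bar B)" if "v \<in> V" for v
  proof (cases v)
    case (Inl x)
    have "card (R v) \<le> card {..<t}" unfolding R_def Inl sum.case by (rule card_image_le) simp
    thus ?thesis using Inl by (auto simp: R_def row_bar_def unit_bar_bar_at)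
  next
    case (Inr j)
    thus ?thesis by (auto simp: R_def t_def side_bar_def unit_bar_bar_at)
  qed
  have disj: "B \<inter> C = {}" if uvBC: "u \<in> V" "v \<in> V" "B \<in> R u" "C \<in> R v" "(u, B) \<noteq> (v, C)" for u v B C
  proof (cases u; cases v)
    fix x y assume uv: "u = Inl x" "v = Inl y"
    obtain k k' where k: "B = row_bar k" "k mod 2 = x" "C = row_bar k'" "k' mod 2 = y"
      using row_of[of B x] row_of[of C y] uvBC uv by (auto simp: V_def)
    hence "k \<noteq> k'" using uvBC uv by auto
    thus ?thesis using row_bar_disjoint k by simp
  next
    fix x j assume uv: "u = Inl x" "v = Inr j"
    thus ?thesis using row_of[of B x] side_of[of C j] that row_side_disjoint by (auto simp: V_def)
  next
    fix x j assume uv: "u = Inr j" "v = Inl x"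
    thus ?thesis using row_of[of C x] side_of[of B j] that row_side_disjoint by (fastforce simp: V_def)
  next
    fix j j' assume uv: "u = Inr j" "v = Inr j'"
    thus ?thesis using side_of[of B j] side_of[of C j'] that side_bar_disjoint[of j j'] by auto
  qed
  have row_no: "\<not> spans_gap \<A> (row_bar k) (row_bar k')" if "k mod 2 \<noteq> k' mod 2" for k k'
  proof -
    have "k + 1 \<le> k' \<or> k' + 1 \<le> k" using that by presburger
    thus ?thesis unfolding row_bar_def spans_gap_bar_at by force
  qed
  have side_no: "\<not> spans_gap \<A> (side_bar j) (side_bar j')" if jj: "j \<noteq> j'" "j < m" "j' < m" for j j'
  proof
    assume "spans_gap \<A> (side_bar j) (side_bar j')"
    then obtain a b where ab: "side_height j < side_height j'" "a < b" "real (j div 2) + 1 / 2 \<le> a"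
      "b \<le> real (j div 2) + 1 / 2 + 1" "real (j' div 2) + 1 / 2 \<le> a" "b \<le> real (j' div 2) + 1 / 2 + 1"
      and empty: "\<forall>D\<in>\<A>. ({a<..<b} \<times> {side_height j<..<side_height j'}) \<inter> D = {}"
      unfolding side_bar_def spans_gap_bar_at by (elim exE conjE)
    \<comment> \<open>An overlap of positive width forces equal intervals, so the two bars lie on
      opposite sides of the row.\<close>
    have eq: "j div 2 = j' div 2"
    proof (rule ccontr)
      assume "j div 2 \<noteq> j' div 2"
      hence "j div 2 + 1 \<le> j' div 2 \<or> j' div 2 + 1 \<le> j div 2" by linarith
      thus False using ab by linarith
    qed
    have "even j \<noteq> even j'" using jj eq div_2_eq_parity by blast
    hence par: "odd j" "even j'" using ab(1) side_height_cases[of j] side_height_cases[of j'] by force+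
    define s where "s = (a + b) / 2"
    \<comment> \<open>A row bar crossing the abscissa \<open>s\<close>; it blocks the sight.\<close>
    define k where "k = (if s \<le> real (j div 2) + 1 then j div 2 else j div 2 + 1)"
    have s: "a < s" "s < b" using ab(2) by (auto simp: s_def)
    have "(s, real (k mod 2)) \<in> row_bar k" using s ab by (auto simp: row_bar_def bar_at_def k_def)
    moreover have "(s, real (k mod 2)) \<in> {a<..<b} \<times> {side_height j<..<side_height j'}"
      using s side_height_cases(2)[OF par(1)] side_height_cases(1)[OF par(2)] row_height_le[of k]
      by simp
    moreover have "k < 2 * t" using jj unfolding k_def t_def by (auto; presburger)
    ultimately show False using empty row_in by blast
  qed
  have row_side: "sees \<A> (row_bar k) (side_bar j)" if k: "k = j div 2 \<or> k = j div 2 + 1" for k j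
  proof -
    define a b where "a = max (real k) (real (j div 2) + 1 / 2)"
      and "b = min (real k + 1) (real (j div 2) + 1 / 2 + 1)"
    have ab: "a < b" "real k \<le> a" "b \<le> real k + 1" "real (j div 2) + 1 / 2 \<le> a"
      "b \<le> real (j div 2) + 1 / 2 + 1"
      using k by (auto simp: a_def b_def)
    \<comment> \<open>The row bar is the lower one for even \<open>j\<close> and the upper one for
      odd \<open>j\<close>; the variables \<open>h\<close> and \<open>h'\<close> treat both cases at
      once.\<close>
    have clear: "({a<..<b} \<times> {h<..<h'}) \<inter> D = {}"
      if D: "D \<in> \<A>" and h: "if even j then h = real (k mod 2) \<and> h' = side_height j
        else h = side_height j \<and> h' = real (k mod 2)" for D h h'
      using A_cases[OF D]
    proof (elim disjE exE)
      fix k' assume D: "D = row_bar k'"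
      show ?thesis
      proof (cases "k' = k")
        case True
        thus ?thesis using D h by (auto simp: row_bar_def bar_at_def split: if_splits)
      next
        case False
        hence "k' + 1 \<le> k \<or> k + 1 \<le> k'" by linarith
        hence "real k' + 1 \<le> real k \<or> real k + 1 \<le> real k'" by linarith
        thus ?thesis using D ab by (auto simp: row_bar_def bar_at_def)
      qed
    next
      fix j' assume D: "D = side_bar j'"
      show ?thesis
      proof (cases "j' div 2 = j div 2")
        case True
        have "j' = j \<or> even j' \<noteq> even j" using True div_2_eq_parity by blast
        thus ?thesis using D h side_height_cases[of j'] row_height_le[of k]
          by (auto simp: side_bar_def bar_at_def split: if_splits)
      next
        case False
        hence "j' div 2 + 1 \<le> j div 2 \<or> j div 2 + 1 \<le> j' div 2" by linarith
        hence "real (j' div 2) + 1 \<le> real (j div 2) \<or> real (j div 2) + 1 \<le> real (j' div 2)" by linarith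
        thus ?thesis using D ab by (auto simp: side_bar_def bar_at_def)
      qed
    qed
    show ?thesis
    proof (cases "even j")
      case True
      hence "real (k mod 2) < side_height j" using side_height_cases[of j] row_height_le[of k] by linarith
      moreover have "\<forall>D\<in>\<A>. ({a<..<b} \<times> {real (k mod 2)<..<side_height j}) \<inter> D = {}"
        using clear True by simp
      ultimately have "spans_gap \<A> (row_bar k) (side_bar j)"
        unfolding row_bar_def side_bar_def spans_gap_bar_at using ab by blast
      thus ?thesis by (simp add: sees_def)
    next
      case False
      hence "side_height j < real (k mod 2)" using side_height_cases[of j] by (smt (verit) of_nat_0_le_iff)
      moreover have "\<forall>D\<in>\<A>. ({a<..<b} \<times> {side_height j<..<real (k mod 2)}) \<inter> D = {}"
        using clear False by simp
      ultimately have "spans_gap \<A> (side_bar j) (row_bar k)"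
        unfolding row_bar_def side_bar_def spans_gap_bar_at using ab by blast
      thus ?thesis by (simp add: sees_def)
    qed
  qed
  have sees_sym: "sees \<A> B C \<longleftrightarrow> sees \<A> C B" for B C by (auto simp: sees_def)
  have cross: "\<exists>B\<in>R (Inl x). \<exists>C\<in>R (Inr j). sees \<A> B C" if "x < 2" "j < m" for x j
  proof -
    obtain k where k: "k = j div 2 \<or> k = j div 2 + 1" "k mod 2 = x"
    proof -
      have "j div 2 mod 2 = x \<or> (j div 2 + 1) mod 2 = x" using \<open>x < 2\<close> by presburger
      thus ?thesis using that by blast
    qed
    have "k < 2 * t" using k(1) that unfolding t_def by presburger
    hence "row_bar k \<in> R (Inl x)" using R_row k(2) by blast
    thus ?thesis using row_side[OF k(1)] by (auto simp: R_def)
  qed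
  have vis: "isl u \<noteq> isl v \<longleftrightarrow> (\<exists>B\<in>R u. \<exists>C\<in>R v. sees \<A> B C)" if "u \<in> V" "v \<in> V" "u \<noteq> v" for u v
  proof (cases u; cases v)
    fix x y assume uv: "u = Inl x" "v = Inl y"
    have "\<not> sees \<A> B C" if BC: "B \<in> R u" "C \<in> R v" for B C
    proof -
      obtain k k' where "B = row_bar k" "k mod 2 = x" "C = row_bar k'" "k' mod 2 = y"
        using row_of[of B x] row_of[of C y] BC uv \<open>u \<in> V\<close> \<open>v \<in> V\<close> by (auto simp: V_def)
      thus ?thesis using row_no[of k k'] row_no[of k' k] uv \<open>u \<noteq> v\<close> by (auto simp: sees_def)
    qed
    thus ?thesis using uv by auto
  next
    fix x j assume uv: "u = Inl x" "v = Inr j"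
    thus ?thesis using cross[of x j] that by (auto simp: V_def)
  next
    fix x j assume uv: "u = Inr j" "v = Inl x"
    hence "\<exists>B\<in>R v. \<exists>C\<in>R u. sees \<A> B C" using cross[of x j] that by (auto simp: V_def)
    thus ?thesis using uv sees_sym by auto
  next
    fix j j' assume uv: "u = Inr j" "v = Inr j'"
    thus ?thesis using side_no[of j j'] side_no[of j' j] that by (auto simp: R_def V_def sees_def)
  qed
  have "unit_bar_visibility_rep t (complete_bipartite_graph 2 m) R"
    unfolding unit_bar_visibility_rep_def V \<A>_def[symmetric]
  proof (rule conjI[OF _ conjI]; intro ballI impI)
    fix v assume "v \<in> V"
    thus "finite (R v) \<and> card (R v) \<le> t \<and> (\<forall>B\<in>R v. unit_bar B)" by (rule size)
  next
    fix u v B C assume "u \<in> V" "v \<in> V" "B \<in> R u" "C \<in> R v" "(u, B) \<noteq> (v, C)"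
    thus "B \<inter> C = {}" by (rule disj)
  next
    fix u v assume uv: "u \<in> V" "v \<in> V" "u \<noteq> v"
    show "(u, v) \<in> parcs (complete_bipartite_graph 2 m) \<longleftrightarrow> (\<exists>B\<in>R u. \<exists>C\<in>R v. sees \<A> B C)"
      by (rule trans[OF arcs[OF uv(1,2)] vis[OF uv]])
  qed
  thus ?thesis unfolding t_def by blast
qed

section \<open>The asymptotic statement\<close>

theorem theorem20:
  shows "(\<lambda>m::nat. real (ub (complete_bipartite_graph 2 m)) - real m / 4) \<in> o(\<lambda>m::nat. real m)"
proof -
  \<comment> \<open>The two bounds leave a constant error, which is \<open>o(m)\<close>; the
    construction also shows that the minimum is attained.\<close>
  have bound: "\<bar>real (ub (complete_bipartite_graph 2 m)) - real m / 4\<bar> \<le> 2" for m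
  proof -
    have "\<exists>R. unit_bar_visibility_rep (ub (complete_bipartite_graph 2 m)) (complete_bipartite_graph 2 m) R"
      unfolding ub_def by (rule LeastI) (rule unit_bar_visibility_rep_upper_bound)
    hence "m \<le> 4 * ub (complete_bipartite_graph 2 m)"
      using unit_bar_visibility_rep_lower_bound by blast
    moreover have "ub (complete_bipartite_graph 2 m) \<le> m div 4 + 2"
      unfolding ub_def by (rule Least_le) (rule unit_bar_visibility_rep_upper_bound)
    moreover have "4 * (m div 4) \<le> m" by simp
    ultimately show ?thesis by linarith
  qed
  have "(\<lambda>m. real (ub (complete_bipartite_graph 2 m)) - real m / 4) \<in> O(\<lambda>_. 1)"
    by (rule bigoI[where c = 2]) (simp add: bound)
  also have "(\<lambda>_. 1) \<in> o(\<lambda>m::nat. real m)"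
    by (rule smalloI_tendsto) (use lim_1_over_n eventually_gt_at_top[of 0] in \<open>auto elim: eventually_mono\<close>)
  finally show ?thesis .
qed

end
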